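(* The category $\mathbf{Boole}$ of Boolean algebras and Boolean homomorphisms and the category $\mathbf{kBoole}$ of compact dz-algebras are isomorphic.
   Context: Boolean algebras with $0=1$ are allowed. $\mathbf{2}=\{0,1\}$ is the two-element Boolean algebra; $\mathbf{Boole}(A,\mathbf 2)$ is the set of Boolean homomorphisms $A\to\mathbf 2$. $\mathrm{CO}(X)$ is the set of clopen subsets of a space $X$. For a Boolean algebra $A$ and $a\in A$, put $s_A(a)=\{x\in \mathbf{Boole}(A,\mathbf 2)\mid x(a)=1\}$; the Stone space $\mathsf S(A)$ is $\mathbf{Boole}(A,\mathbf 2)$ with the topology having $\{s_A(a)\mid a\in A\}$ as a base. For $X\subseteq \mathbf{Boole}(A,\mathbf 2)$ put $s_A^X(a)=X\cap s_A(a)$. A Boolean z-algebra is a pair $(A,X)$, where $A$ is a Boolean algebra and $X\subseteq\mathbf{Boole}(A,\mathbf 2)$, such that for each $a\in A\setminus\{0\}$ there is $x\in X$ with $x(a)=1$. A Boolean dz-algebra is a Boolean z-algebra $(A,X)$ such that $s_A^X(A)=\mathrm{CO}(X)$, where $X$ carries the subspace topology from $\mathsf S(A)$. $\mathbf{dzBoole}$ is the category whose objects are all Boolean dz-algebras and whose morphisms $(A,X)\to(A',X')$ are all pairs $(\varphi,f)$ with $\varphi:A\to A'$ a Boolean homomorphism and $f:X'\to X$ a function such that $x'\circ\varphi=f(x')$ for every $x'\in X'$; composition is $(\varphi',f')\circ(\varphi,f)=(\varphi'\circ\varphi,f\circ f')$ and identities are $(id_A,id_X)$. A compact dz-algebra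 is a pair $(A,\mathbf{Boole}(A,\mathbf 2))$ with $A$ a Boolean algebra (such a pair is a Boolean dz-algebra). $\mathbf{kBoole}$ is the full subcategory of $\mathbf{dzBoole}$ whose objects are all compact dz-algebras. *)

theory Defs
  imports "HOL-Analysis.Abstract_Topology" "HOL-Library.FuncSet"
begin

section \<open>Categories, functors, isomorphism of categories\<close>

text \<open>
  Composition and identities are indexed by objects, so that the same function may be an arrow
  between several pairs of objects.  \<open>Comp C x y z g f\<close> is the composite of
  \<open>f : x \<rightarrow> y\<close> and \<open>g : y \<rightarrow> z\<close>.
\<close>

record ('o, 'm) cat =
  Obj :: "'o set"
  Hom :: "'o \<Rightarrow> 'o \<Rightarrow> 'm set"
  Ident :: "'o \<Rightarrow> 'm"
  Comp :: "'o \<Rightarrow> 'o \<Rightarrow> 'o \<Rightarrow> 'm \<Rightarrow> 'm \<Rightarrow> 'm"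

locale category =
  fixes C :: "('o, 'm) cat"
  assumes hom_obj: "f \<in> Hom C x y \<Longrightarrow> x \<in> Obj C \<and> y \<in> Obj C"
    and ident_hom: "x \<in> Obj C \<Longrightarrow> Ident C x \<in> Hom C x x"
    and comp_hom: "\<lbrakk>f \<in> Hom C x y; g \<in> Hom C y z\<rbrakk> \<Longrightarrow> Comp C x y z g f \<in> Hom C x z"
    and comp_ident_right: "f \<in> Hom C x y \<Longrightarrow> Comp C x x y f (Ident C x) = f"
    and comp_ident_left: "f \<in> Hom C x y \<Longrightarrow> Comp C x y y (Ident C y) f = f"
    and comp_assoc: "\<lbrakk>f \<in> Hom C w x; g \<in> Hom C x y; h \<in> Hom C y z\<rbrakk> \<Longrightarrow>
      Comp C w y z h (Comp C w x y g f) = Comp C w x z (Comp C x y z h g) f"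

locale cat_functor = dom: category C + cod: category D
  for C :: "('o, 'm) cat" and D :: "('p, 'n) cat" +
  fixes Fo :: "'o \<Rightarrow> 'p" and Fm :: "'o \<Rightarrow> 'o \<Rightarrow> 'm \<Rightarrow> 'n"
  assumes map_obj: "x \<in> Obj C \<Longrightarrow> Fo x \<in> Obj D"
    and map_hom: "f \<in> Hom C x y \<Longrightarrow> Fm x y f \<in> Hom D (Fo x) (Fo y)"
    and map_ident: "x \<in> Obj C \<Longrightarrow> Fm x x (Ident C x) = Ident D (Fo x)"
    and map_comp: "\<lbrakk>f \<in> Hom C x y; g \<in> Hom C y z\<rbrakk> \<Longrightarrow>
      Fm x z (Comp C x y z g f) = Comp D (Fo x) (Fo y) (Fo z) (Fm y z g) (Fm x y f)"

definition isomorphic_categories :: "('o, 'm) cat \<Rightarrow> ('p, 'n) cat \<Rightarrow> bool" where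
  "isomorphic_categories C D \<longleftrightarrow> category C \<and> category D \<and>
    (\<exists>Fo Fm Go Gm. cat_functor C D Fo Fm \<and> cat_functor D C Go Gm \<and>
      (\<forall>x\<in>Obj C. Go (Fo x) = x) \<and>
      (\<forall>x\<in>Obj C. \<forall>y\<in>Obj C. \<forall>f\<in>Hom C x y. Gm (Fo x) (Fo y) (Fm x y f) = f) \<and>
      (\<forall>u\<in>Obj D. Fo (Go u) = u) \<and>
      (\<forall>u\<in>Obj D. \<forall>v\<in>Obj D. \<forall>g\<in>Hom D u v. Fm (Go u) (Go v) (Gm u v g) = g))"

definition full_subcategory :: "('o, 'm) cat \<Rightarrow> 'o set \<Rightarrow> ('o, 'm) cat" where
  "full_subcategory C S =
    \<lparr>Obj = S,
     Hom = (\<lambda>x y. if x \<in> S \<and> y \<in> S then Hom C x y else {}),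
     Ident = Ident C,
     Comp = Comp C\<rparr>"


section \<open>The category of Boolean algebras\<close>

text \<open>
  Carriers are arbitrary subsets of the type \<open>'a\<close>.  The operations, and likewise all maps between
  carriers below, are required to be \<open>undefined\<close> outside the carrier, so that two Boolean algebras
  (or two maps) are equal in HOL exactly if they are equal as mathematical structures.
  The degenerate case \<open>zero = one\<close> is not excluded.
\<close>

record 'a balg =
  carr :: "'a set"
  join :: "'a \<Rightarrow> 'a \<Rightarrow> 'a"
  meet :: "'a \<Rightarrow> 'a \<Rightarrow> 'a"
  compl :: "'a \<Rightarrow> 'a"
  zero :: 'a
  one :: 'a

locale bool_alg =
  fixes A :: "'a balg"
  assumes join_closed: "\<lbrakk>a \<in> carr A; b \<in> carr A\<rbrakk> \<Longrightarrow> join A a b \<in> carr A"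
    and meet_closed: "\<lbrakk>a \<in> carr A; b \<in> carr A\<rbrakk> \<Longrightarrow> meet A a b \<in> carr A"
    and compl_closed: "a \<in> carr A \<Longrightarrow> compl A a \<in> carr A"
    and zero_closed: "zero A \<in> carr A"
    and one_closed: "one A \<in> carr A"
    and join_extensional: "\<not> (a \<in> carr A \<and> b \<in> carr A) \<Longrightarrow> join A a b = undefined"
    and meet_extensional: "\<not> (a \<in> carr A \<and> b \<in> carr A) \<Longrightarrow> meet A a b = undefined"
    and compl_extensional: "a \<notin> carr A \<Longrightarrow> compl A a = undefined"
    and join_assoc: "\<lbrakk>a \<in> carr A; b \<in> carr A; c \<in> carr A\<rbrakk> \<Longrightarrow>
      join A (join A a b) c = join A a (join A b c)"
    and meet_assoc: "\<lbrakk>a \<in> carr A; b \<in> carr A; c \<in> carr A\<rbrakk> \<Longrightarrow>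
      meet A (meet A a b) c = meet A a (meet A b c)"
    and join_commute: "\<lbrakk>a \<in> carr A; b \<in> carr A\<rbrakk> \<Longrightarrow> join A a b = join A b a"
    and meet_commute: "\<lbrakk>a \<in> carr A; b \<in> carr A\<rbrakk> \<Longrightarrow> meet A a b = meet A b a"
    and join_absorb: "\<lbrakk>a \<in> carr A; b \<in> carr A\<rbrakk> \<Longrightarrow> join A a (meet A a b) = a"
    and meet_absorb: "\<lbrakk>a \<in> carr A; b \<in> carr A\<rbrakk> \<Longrightarrow> meet A a (join A a b) = a"
    and join_distrib: "\<lbrakk>a \<in> carr A; b \<in> carr A; c \<in> carr A\<rbrakk> \<Longrightarrow>
      join A a (meet A b c) = meet A (join A a b) (join A a c)"
    and meet_distrib: "\<lbrakk>a \<in> carr A; b \<in> carr A; c \<in> carr A\<rbrakk> \<Longrightarrow>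
      meet A a (join A b c) = join A (meet A a b) (meet A a c)"
    and join_zero: "a \<in> carr A \<Longrightarrow> join A a (zero A) = a"
    and meet_one: "a \<in> carr A \<Longrightarrow> meet A a (one A) = a"
    and join_compl: "a \<in> carr A \<Longrightarrow> join A a (compl A a) = one A"
    and meet_compl: "a \<in> carr A \<Longrightarrow> meet A a (compl A a) = zero A"

definition bool_hom :: "'a balg \<Rightarrow> 'b balg \<Rightarrow> ('a \<Rightarrow> 'b) set" where
  "bool_hom A B = {h \<in> carr A \<rightarrow>\<^sub>E carr B.
     (\<forall>a\<in>carr A. \<forall>b\<in>carr A. h (join A a b) = join B (h a) (h b)) \<and>
     (\<forall>a\<in>carr A. \<forall>b\<in>carr A. h (meet A a b) = meet B (h a) (h b)) \<and>
     (\<forall>a\<in>carr A. h (compl A a) = compl B (h a)) \<and>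
     h (zero A) = zero B \<and> h (one A) = one B}"

definition Boole :: "('a balg, 'a \<Rightarrow> 'a) cat" where
  "Boole =
    \<lparr>Obj = {A. bool_alg A},
     Hom = (\<lambda>A B. if bool_alg A \<and> bool_alg B then bool_hom A B else {}),
     Ident = (\<lambda>A. \<lambda>a\<in>carr A. a),
     Comp = (\<lambda>A B C \<psi> \<phi>. compose (carr A) \<psi> \<phi>)\<rparr>"

definition two :: "bool balg" where
  "two = \<lparr>carr = UNIV, join = (\<or>), meet = (\<and>), compl = Not, zero = False, one = True\<rparr>"

lemma bool_alg_two: "bool_alg two"
  by unfold_locales (auto simp: two_def)


section \<open>Stone spaces, z-algebras and dz-algebras\<close>

text \<open>The elements of \<open>points A\<close> are the Boolean homomorphisms into \<^const>\<open>two\<close>.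
  They are predicates, so \<open>x a\<close> expresses that \<open>x\<close> takes the value one at \<open>a\<close>.\<close>

definition points :: "'a balg \<Rightarrow> ('a \<Rightarrow> bool) set" where
  "points A = bool_hom A two"

definition stone_set :: "'a balg \<Rightarrow> 'a \<Rightarrow> ('a \<Rightarrow> bool) set" where
  "stone_set A a = {x \<in> points A. x a}"

definition stone_space :: "'a balg \<Rightarrow> ('a \<Rightarrow> bool) topology" where
  "stone_space A = topology (arbitrary union_of (\<lambda>U. U \<in> stone_set A ` carr A))"

lemma stone_set_meet:
  assumes "a \<in> carr A" "b \<in> carr A"
  shows "stone_set A a \<inter> stone_set A b = stone_set A (meet A a b)"
  using assms by (auto simp: stone_set_def points_def bool_hom_def two_def)

text \<open>\<^const>\<open>topology\<close> is only specified on families that are topologies; the next lemma confirms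
  that the sets \<^const>\<open>stone_set\<close> really are a base.\<close>

lemma openin_stone_space:
  assumes "bool_alg A"
  shows "openin (stone_space A) = arbitrary union_of (\<lambda>U. U \<in> stone_set A ` carr A)"
proof -
  have "istopology (arbitrary union_of (\<lambda>U. U \<in> stone_set A ` carr A))"
    by (rule istopology_base)
      (auto simp: stone_set_meet bool_alg.meet_closed[OF assms] intro!: imageI)
  then show ?thesis
    by (simp add: stone_space_def)
qed

lemma topspace_stone_space:
  assumes "bool_alg A"
  shows "topspace (stone_space A) = points A"
proof -
  have "stone_set A (one A) = points A"
    by (auto simp: stone_set_def points_def bool_hom_def two_def)
  then have "openin (stone_space A) (points A)"
    using bool_alg.one_closed[OF assms]
    by (auto simp: openin_stone_space[OF assms] intro!: arbitrary_union_of_inc)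
  moreover have "U \<subseteq> points A" if "openin (stone_space A) U" for U
    using that by (auto simp: openin_stone_space[OF assms] union_of_def stone_set_def)
  ultimately show ?thesis
    by (metis openin_subset openin_topspace subset_antisym)
qed

definition clopens :: "'b topology \<Rightarrow> 'b set set" where
  "clopens T = {U. openin T U \<and> closedin T U}"

definition z_algebra :: "'a balg \<times> ('a \<Rightarrow> bool) set \<Rightarrow> bool" where
  "z_algebra = (\<lambda>(A, X). bool_alg A \<and> X \<subseteq> points A \<and>
     (\<forall>a\<in>carr A - {zero A}. \<exists>x\<in>X. x a))"

definition dz_algebra :: "'a balg \<times> ('a \<Rightarrow> bool) set \<Rightarrow> bool" where
  "dz_algebra = (\<lambda>(A, X). z_algebra (A, X) \<and>
     (\<lambda>a. X \<inter> stone_set A a) ` carr A = clopens (subtopology (stone_space A) X))"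

definition dz_hom ::
  "'a balg \<times> ('a \<Rightarrow> bool) set \<Rightarrow> 'a balg \<times> ('a \<Rightarrow> bool) set \<Rightarrow>
   (('a \<Rightarrow> 'a) \<times> (('a \<Rightarrow> bool) \<Rightarrow> ('a \<Rightarrow> bool))) set" where
  "dz_hom = (\<lambda>(A, X) (A', X').
     {(\<phi>, f). \<phi> \<in> bool_hom A A' \<and> f \<in> X' \<rightarrow>\<^sub>E X \<and> (\<forall>x'\<in>X'. compose (carr A) x' \<phi> = f x')})"

definition dzBoole ::
  "('a balg \<times> ('a \<Rightarrow> bool) set, ('a \<Rightarrow> 'a) \<times> (('a \<Rightarrow> bool) \<Rightarrow> ('a \<Rightarrow> bool))) cat" where
  "dzBoole =
    \<lparr>Obj = {P. dz_algebra P},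
     Hom = (\<lambda>P Q. if dz_algebra P \<and> dz_algebra Q then dz_hom P Q else {}),
     Ident = (\<lambda>(A, X). (\<lambda>a\<in>carr A. a, \<lambda>x\<in>X. x)),
     Comp = (\<lambda>(A, X) (A', X') (A'', X'') (\<phi>', f') (\<phi>, f).
       (compose (carr A) \<phi>' \<phi>, compose X'' f f'))\<rparr>"

definition compact_dz_algebras :: "('a balg \<times> ('a \<Rightarrow> bool) set) set" where
  "compact_dz_algebras = {(A, points A) | A. bool_alg A}"

text \<open>The hom-sets of \<^const>\<open>dzBoole\<close> are empty away from its objects, so \<open>category kBoole\<close> can only
  hold if all compact dz-algebras are in fact dz-algebras.\<close>

definition kBoole ::
  "('a balg \<times> ('a \<Rightarrow> bool) set, ('a \<Rightarrow> 'a) \<times> (('a \<Rightarrow> bool) \<Rightarrow> ('a \<Rightarrow> bool))) cat" where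
  "kBoole = full_subcategory dzBoole compact_dz_algebras"

end

(* The functor from Boole to kBoole sends A to (A, points A), and a homomorphism phi to the pair of
   phi and precomposition with phi; the second component of a morphism of kBoole is forced, so the
   projection to the first component is an inverse.  The content is that (A, points A) is a
   dz-algebra.  By Zorn's lemma a proper ideal is disjoint from some ultrafilter.  Applied to the
   principal ideal of the complement of a nonzero a, this gives the z-condition.  If U is clopen,
   then the elements whose Stone set lies in U and those whose Stone set misses U form two ideals,
   and no point vanishes on both of them; hence one = join a b with a in the first and b in the
   second, and U is the Stone set of a. *)
theory Submission
  imports Defs
begin

section \<open>The Boolean prime ideal theorem\<close>

text \<open>Downward closure is phrased by meets because \<open>balg\<close> carries no order: an
  element c below a equals \<open>meet A a c\<close>. Properness is left out and stated separately
  as \<open>one A \<notin> I\<close>.\<close>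

definition balg_ideal :: "'a balg \<Rightarrow> 'a set \<Rightarrow> bool" where
  "balg_ideal A I \<longleftrightarrow> I \<subseteq> carr A \<and> zero A \<in> I \<and>
     (\<forall>a\<in>I. \<forall>b\<in>I. join A a b \<in> I) \<and> (\<forall>a\<in>I. \<forall>b\<in>carr A. meet A a b \<in> I)"

lemma balg_idealI:
  assumes "I \<subseteq> carr A" "zero A \<in> I"
    and "\<And>a b. \<lbrakk>a \<in> I; b \<in> I\<rbrakk> \<Longrightarrow> join A a b \<in> I"
    and "\<And>a b. \<lbrakk>a \<in> I; b \<in> carr A\<rbrakk> \<Longrightarrow> meet A a b \<in> I"
  shows "balg_ideal A I"
  using assms by (auto simp: balg_ideal_def)

lemma balg_idealD:
  assumes "balg_ideal A I"
  shows "I \<subseteq> carr A" "zero A \<in> I"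
    and "\<And>a b. \<lbrakk>a \<in> I; b \<in> I\<rbrakk> \<Longrightarrow> join A a b \<in> I"
    and "\<And>a b. \<lbrakk>a \<in> I; b \<in> carr A\<rbrakk> \<Longrightarrow> meet A a b \<in> I"
  using assms by (auto simp: balg_ideal_def)

text \<open>Points are characteristic functions of ultrafilters; the operations of
  \<open>two\<close> become logical connectives, so later goals about points are
  propositional.\<close>

lemma points_iff:
  "x \<in> points A \<longleftrightarrow> x \<in> extensional (carr A) \<and>
     (\<forall>a\<in>carr A. \<forall>b\<in>carr A. x (join A a b) \<longleftrightarrow> x a \<or> x b) \<and>
     (\<forall>a\<in>carr A. \<forall>b\<in>carr A. x (meet A a b) \<longleftrightarrow> x a \<and> x b) \<and>
     (\<forall>a\<in>carr A. x (compl A a) \<longleftrightarrow> \<not> x a) \<and> \<not> x (zero A) \<and> x (one A)"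
  by (auto simp: points_def bool_hom_def two_def PiE_def)

text \<open>The chain condition of Zorn's lemma. Comparability matters only for joins, where two
  elements must be brought into one member; nonemptiness supplies \<open>zero A\<close>.\<close>

lemma balg_ideal_Union_chain:
  assumes "subset.chain {I. balg_ideal A I \<and> one A \<notin> I} \<C>" "\<C> \<noteq> {}"
  shows "balg_ideal A (\<Union>\<C>) \<and> one A \<notin> \<Union>\<C>"
proof
  have id: "balg_ideal A I" and one: "one A \<notin> I" if "I \<in> \<C>" for I
    using assms(1) that by (auto simp: subset_chain_def)
  show "one A \<notin> \<Union>\<C>"
    using one by blast
  show "balg_ideal A (\<Union>\<C>)"
  proof (rule balg_idealI)
    show "\<Union>\<C> \<subseteq> carr A"
      using balg_idealD(1)[OF id] by (rule Union_least)
    show "zero A \<in> \<Union>\<C>"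
      using balg_idealD(2)[OF id] assms(2) by auto
    show "meet A a b \<in> \<Union>\<C>" if "a \<in> \<Union>\<C>" "b \<in> carr A" for a b
      using balg_idealD(4)[OF id] that by auto
    show "join A a b \<in> \<Union>\<C>" if ab: "a \<in> \<Union>\<C>" "b \<in> \<Union>\<C>" for a b
    proof -
      from ab obtain I J where IJ: "I \<in> \<C>" "a \<in> I" "J \<in> \<C>" "b \<in> J"
        by blast
      then have "I \<subseteq> J \<or> J \<subseteq> I"
        using assms(1) by (auto simp: subset_chain_def)
      then show ?thesis
      proof
        assume "I \<subseteq> J"
        then show ?thesis
          using IJ balg_idealD(3)[OF id[OF IJ(3)], of a b] by blast
      next
        assume "J \<subseteq> I"
        then show ?thesis
          using IJ balg_idealD(3)[OF id[OF IJ(1)], of a b] by blast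
      qed
    qed
  qed
qed

context bool_alg
begin

lemma meet_zero: "a \<in> carr A \<Longrightarrow> meet A a (zero A) = zero A"
  using meet_absorb[of "zero A" a] join_zero[of a] join_commute[of a "zero A"]
    meet_commute[of a "zero A"] zero_closed by simp

text \<open>The ideal quotient (M : e). It serves twice: for a maximal M it yields primality, and
  for the zero ideal it is the annihilator of e.\<close>

lemma balg_ideal_residual:
  assumes M: "balg_ideal A M" and e: "e \<in> carr A"
  shows "balg_ideal A {c \<in> carr A. meet A c e \<in> M}"
proof (rule balg_idealI)
  note D = balg_idealD[OF M]
  show "{c \<in> carr A. meet A c e \<in> M} \<subseteq> carr A"
    by blast
  show "zero A \<in> {c \<in> carr A. meet A c e \<in> M}"
    using D(2,4) e zero_closed by blast
  show "join A a b \<in> {c \<in> carr A. meet A c e \<in> M}"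
    if "a \<in> {c \<in> carr A. meet A c e \<in> M}" "b \<in> {c \<in> carr A. meet A c e \<in> M}" for a b
  proof -
    have "meet A (join A a b) e = join A (meet A a e) (meet A b e)"
      using that e meet_distrib[of e a b] meet_commute join_closed by simp
    then show ?thesis
      using that D(3) join_closed by simp
  qed
  show "meet A a b \<in> {c \<in> carr A. meet A c e \<in> M}"
    if "a \<in> {c \<in> carr A. meet A c e \<in> M}" "b \<in> carr A" for a b
  proof -
    have "meet A (meet A a b) e = meet A (meet A a e) b"
      using that e meet_assoc meet_commute by simp
    then show ?thesis
      using that D(4) meet_closed by simp
  qed
qed

lemma maximal_balg_ideal_point:
  assumes M: "balg_ideal A M" and one: "one A \<notin> M"
    and max: "\<And>N. \<lbrakk>balg_ideal A N; one A \<notin> N; M \<subseteq> N\<rbrakk> \<Longrightarrow> N = M"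
  shows "(\<lambda>a\<in>carr A. a \<notin> M) \<in> points A"
proof -
  note D = balg_idealD[OF M]
  have prime: "a \<in> M \<or> b \<in> M" if "a \<in> carr A" "b \<in> carr A" "meet A a b \<in> M" for a b
  proof (rule ccontr)
    assume n: "\<not> (a \<in> M \<or> b \<in> M)"
    \<comment> \<open>This quotient contains M and a, and it is proper because b lies outside M.
      Maximality then forces a into M.\<close>
    let ?N = "{c \<in> carr A. meet A c b \<in> M}"
    have "M \<subseteq> ?N" "a \<in> ?N"
      using D that by auto
    moreover have "one A \<notin> ?N"
      using n that meet_commute[of "one A" b] meet_one one_closed by simp
    ultimately show False
      using max[OF balg_ideal_residual[OF M that(2)]] n by blast
  qed
  \<comment> \<open>Absorption recovers a and b as meets with their join, so an ideal containing the
    join contains both.\<close>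
  have join: "join A a b \<in> M \<longleftrightarrow> a \<in> M \<and> b \<in> M" if "a \<in> carr A" "b \<in> carr A" for a b
  proof
    assume "join A a b \<in> M"
    then have "meet A (join A a b) a \<in> M" "meet A (join A a b) b \<in> M"
      using D(4) that by blast+
    moreover have "meet A (join A a b) a = a"
      using meet_absorb[OF that] meet_commute join_closed that by simp
    moreover have "meet A (join A a b) b = b"
      using meet_absorb[OF that(2,1)] meet_commute join_closed join_commute that by simp
    ultimately show "a \<in> M \<and> b \<in> M"
      by simp
  qed (use D(3) in blast)
  have meet: "meet A a b \<in> M \<longleftrightarrow> a \<in> M \<or> b \<in> M" if "a \<in> carr A" "b \<in> carr A" for a b
    using prime[OF that] D(4) that meet_commute by metis
  \<comment> \<open>The join of a and its complement is \<open>one A\<close>, so not both lie in M;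
    their meet is \<open>zero A\<close>, so by primality at least one does.\<close>
  have compl: "compl A a \<in> M \<longleftrightarrow> a \<notin> M" if "a \<in> carr A" for a
    using join[OF that compl_closed[OF that]] meet[OF that compl_closed[OF that]]
      join_compl[OF that] meet_compl[OF that] one D(2) by auto
  show ?thesis
    using join meet compl one D(2)
    by (auto simp: points_iff join_closed meet_closed compl_closed one_closed zero_closed)
qed

lemma exists_point_avoiding_ideal:
  assumes I: "balg_ideal A I" and one: "one A \<notin> I"
  shows "\<exists>x\<in>points A. \<forall>a\<in>I. \<not> x a"
proof -
  let ?P = "{J. (balg_ideal A J \<and> one A \<notin> J) \<and> I \<subseteq> J}"
  have "\<exists>M\<in>?P. \<forall>N\<in>?P. M \<subseteq> N \<longrightarrow> N = M"
  proof (rule subset_Zorn_nonempty)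
    show "?P \<noteq> {}"
      using I one by blast
    show "\<Union>\<C> \<in> ?P" if ne: "\<C> \<noteq> {}" and ch: "subset.chain ?P \<C>" for \<C>
    proof -
      have "subset.chain {I. balg_ideal A I \<and> one A \<notin> I} \<C>" "\<forall>J\<in>\<C>. I \<subseteq> J"
        using ch by (auto simp: subset_chain_def)
      then show ?thesis
        using balg_ideal_Union_chain[of A \<C>] ne by auto
    qed
  qed
  then obtain M where M: "balg_ideal A M" "one A \<notin> M" "I \<subseteq> M"
    and max: "\<forall>N\<in>?P. M \<subseteq> N \<longrightarrow> N = M"
    by blast
  show ?thesis
  proof
    show "(\<lambda>a\<in>carr A. a \<notin> M) \<in> points A"
      \<comment> \<open>An ideal above M also contains I, so maximality within \<open>?P\<close> is
        maximality among all proper ideals.\<close>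
      by (rule maximal_balg_ideal_point[OF M(1,2)]) (use max M(3) in auto)
    \<comment> \<open>Outside the carrier the restricted function is \<open>undefined\<close>, so
      \<open>I \<subseteq> carr A\<close> is essential here.\<close>
    show "\<forall>a\<in>I. \<not> (\<lambda>a\<in>carr A. a \<notin> M) a"
      using M(3) balg_idealD(1)[OF I] by auto
  qed
qed

section \<open>Compact dz-algebras are dz-algebras\<close>

text \<open>At each point a join holds iff one of its arguments does, and \<open>zero A\<close>
  never holds. So this works for an arbitrary set U, open or not.\<close>

lemma balg_ideal_stone_set_subset: "balg_ideal A {a \<in> carr A. stone_set A a \<subseteq> U}"
  by (rule balg_idealI)
    (auto simp: stone_set_def points_iff join_closed meet_closed zero_closed)

text \<open>The sum of two ideals. Distributivity gives closure under meets, since it splits a meet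
  with a sum into a meet in each ideal.\<close>

lemma balg_ideal_join:
  assumes I: "balg_ideal A I" and J: "balg_ideal A J"
  shows "balg_ideal A {join A a b | a b. a \<in> I \<and> b \<in> J}"
proof (rule balg_idealI)
  note DI = balg_idealD[OF I] and DJ = balg_idealD[OF J]
  let ?K = "{join A a b | a b. a \<in> I \<and> b \<in> J}"
  show "?K \<subseteq> carr A"
    using DI(1) DJ(1) join_closed by blast
  have "zero A = join A (zero A) (zero A)"
    using join_zero zero_closed by simp
  then show "zero A \<in> ?K"
    using DI(2) DJ(2) by blast
  show "join A c d \<in> ?K" if "c \<in> ?K" "d \<in> ?K" for c d
  proof -
    from that obtain a b a' b' where c: "c = join A a b" "a \<in> I" "b \<in> J"
      and d: "d = join A a' b'" "a' \<in> I" "b' \<in> J"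
      by blast
    then have mem: "a \<in> carr A" "b \<in> carr A" "a' \<in> carr A" "b' \<in> carr A"
      using DI(1) DJ(1) by auto
    \<comment> \<open>Interchanging b and a' groups the summands from I and those from J.\<close>
    then have "join A b (join A a' b') = join A a' (join A b b')"
      using join_assoc join_commute by metis
    then have "join A c d = join A (join A a a') (join A b b')"
      using c d mem by (simp add: join_assoc join_closed)
    then show ?thesis
      using c d DI(3) DJ(3) by blast
  qed
  show "meet A c e \<in> ?K" if "c \<in> ?K" and e: "e \<in> carr A" for c e
  proof -
    from that obtain a b where c: "c = join A a b" "a \<in> I" "b \<in> J"
      by blast
    then have mem: "a \<in> carr A" "b \<in> carr A"
      using DI(1) DJ(1) by auto
    have "meet A c e = join A (meet A a e) (meet A b e)"
      using c mem e meet_distrib[of e a b] meet_commute join_closed by simp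
    then show ?thesis
      using c e DI(4) DJ(4) by blast
  qed
qed

lemma openin_stone_space_iff:
  "openin (stone_space A) U \<longleftrightarrow>
     U \<subseteq> points A \<and> (\<forall>x\<in>U. \<exists>a\<in>carr A. x a \<and> stone_set A a \<subseteq> U)"
    (is "?L \<longleftrightarrow> ?R")
proof
  assume ?L
  then obtain \<B> where \<B>: "\<B> \<subseteq> stone_set A ` carr A" and U: "\<Union>\<B> = U"
    by (auto simp: openin_stone_space[OF bool_alg_axioms] union_of_def)
  show ?R
  proof (intro conjI ballI)
    show "U \<subseteq> points A"
      using \<B> U by (auto simp: stone_set_def)
    fix x assume "x \<in> U"
    then obtain S where S: "S \<in> \<B>" "x \<in> S"
      using U by blast
    then obtain a where "a \<in> carr A" "S = stone_set A a"
      using \<B> by blast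
    then show "\<exists>a\<in>carr A. x a \<and> stone_set A a \<subseteq> U"
      using S U by (auto simp: stone_set_def)
  qed
next
  assume R: ?R
  \<comment> \<open>U is exhibited as the union of all basic sets that it contains.\<close>
  have "x \<in> \<Union>{S \<in> stone_set A ` carr A. S \<subseteq> U}" if x: "x \<in> U" for x
  proof -
    have "\<exists>a\<in>carr A. x a \<and> stone_set A a \<subseteq> U"
      by (rule bspec[OF conjunct2[OF R] x])
    then obtain a where a: "a \<in> carr A" "x a" "stone_set A a \<subseteq> U"
      by (elim bexE conjE)
    have "x \<in> stone_set A a"
      using R x a(2) by (auto simp: stone_set_def)
    moreover have "stone_set A a \<in> {S \<in> stone_set A ` carr A. S \<subseteq> U}"
      using a(1,3) by simp
    ultimately show ?thesis
      by (rule UnionI[rotated])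
  qed
  then have "\<Union>{S \<in> stone_set A ` carr A. S \<subseteq> U} = U"
    by (intro subset_antisym Union_least subsetI[of U]) simp_all
  then show ?L
    unfolding openin_stone_space[OF bool_alg_axioms] union_of_def arbitrary_def
    by (intro exI[of _ "{S \<in> stone_set A ` carr A. S \<subseteq> U}"]) auto
qed

text \<open>Ideals take the place of compactness: since they are closed under joins, a finite
  subcover shrinks to one element for U and one for its complement.\<close>

lemma clopens_stone_space: "clopens (stone_space A) = stone_set A ` carr A"
proof (intro subset_antisym subsetI)
  fix U assume "U \<in> clopens (stone_space A)"
  then have U: "openin (stone_space A) U" and V: "openin (stone_space A) (points A - U)"
    by (auto simp: clopens_def closedin_def topspace_stone_space[OF bool_alg_axioms])
  define ideal where "ideal W = {a \<in> carr A. stone_set A a \<subseteq> W}" for W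
  \<comment> \<open>The sum of the two ideals; showing that it is improper produces the required
    decomposition of \<open>one A\<close>.\<close>
  define K where "K = {join A a b | a b. a \<in> ideal U \<and> b \<in> ideal (points A - U)}"
  have K: "balg_ideal A K"
    unfolding K_def ideal_def by (intro balg_ideal_join balg_ideal_stone_set_subset)
  have zero: "zero A \<in> ideal W" for W
    unfolding ideal_def by (rule balg_idealD(2)[OF balg_ideal_stone_set_subset])
  have "ideal U \<subseteq> K"
  proof
    fix a assume "a \<in> ideal U"
    moreover from this have "a = join A a (zero A)"
      by (simp add: ideal_def join_zero)
    ultimately show "a \<in> K"
      unfolding K_def using zero by blast
  qed
  have "ideal (points A - U) \<subseteq> K"
  proof
    fix a assume "a \<in> ideal (points A - U)"
    moreover from this have "a = join A (zero A) a"
      by (simp add: ideal_def join_zero join_commute[OF zero_closed])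
    ultimately show "a \<in> K"
      unfolding K_def using zero by blast
  qed
  have ideal_hit: "\<exists>a\<in>ideal W. x a" if "openin (stone_space A) W" "x \<in> W" for x W
    using that by (auto simp: openin_stone_space_iff ideal_def)
  \<comment> \<open>Openness of U handles the points inside U, and closedness handles the
    others.\<close>
  have hit: "\<exists>a\<in>K. x a" if x: "x \<in> points A" for x
  proof (cases "x \<in> U")
    case True
    then obtain a where "a \<in> ideal U" "x a"
      using ideal_hit[OF U] by auto
    then show ?thesis
      using \<open>ideal U \<subseteq> K\<close> by auto
  next
    case False
    then obtain a where "a \<in> ideal (points A - U)" "x a"
      using ideal_hit[OF V, of x] x by auto
    then show ?thesis
      using \<open>ideal (points A - U) \<subseteq> K\<close> by auto
  qed
  have "one A \<in> K"
  proof (rule ccontr)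
    assume "one A \<notin> K"
    from exists_point_avoiding_ideal[OF K this] obtain x where "x \<in> points A" "\<forall>a\<in>K. \<not> x a"
      by (rule bexE)
    then show False
      using hit[of x] by simp
  qed
  then obtain a b where one: "one A = join A a b" and a: "a \<in> carr A" "stone_set A a \<subseteq> U"
    and b: "b \<in> carr A" "stone_set A b \<subseteq> points A - U"
    by (auto simp: K_def ideal_def)
  \<comment> \<open>Every point satisfies a or b, and b fails throughout U.\<close>
  have "x a" if "x \<in> U" for x
  proof -
    have x: "x \<in> points A"
      using U that by (auto simp: openin_stone_space_iff)
    then have "x (join A a b)"
      by (simp add: points_iff flip: one)
    then have "x a \<or> x b"
      using x a(1) b(1) by (simp add: points_iff)
    then show ?thesis
      using b(2) that x by (auto simp: stone_set_def)
  qed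
  then have "U = stone_set A a"
    using a U by (auto simp: openin_stone_space_iff stone_set_def)
  then show "U \<in> stone_set A ` carr A"
    using a(1) by blast
next
  fix U assume "U \<in> stone_set A ` carr A"
  then obtain a where a: "a \<in> carr A" and U: "U = stone_set A a"
    by blast
  have "openin (stone_space A) (stone_set A b)" if "b \<in> carr A" for b
    using that by (auto simp: openin_stone_space_iff stone_set_def)
  moreover have "points A - stone_set A a = stone_set A (compl A a)"
    using a by (auto simp: stone_set_def points_iff)
  moreover have "stone_set A a \<subseteq> points A"
    by (auto simp: stone_set_def)
  ultimately show "U \<in> clopens (stone_space A)"
    using a by (simp add: U clopens_def closedin_def compl_closed
        topspace_stone_space[OF bool_alg_axioms])
qed

lemma exists_point_at:
  assumes a: "a \<in> carr A" "a \<noteq> zero A"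
  shows "\<exists>x\<in>points A. x a"
proof -
  \<comment> \<open>The annihilator of a, which is the principal ideal of \<open>compl A a\<close>.
    Membership in the singleton matches the form of \<open>balg_ideal_residual\<close>; properness
    is exactly \<open>a \<noteq> zero A\<close>.\<close>
  let ?I = "{c \<in> carr A. meet A c a \<in> {zero A}}"
  have "balg_ideal A {zero A}"
    by (rule balg_idealI)
      (use zero_closed join_zero meet_zero meet_commute in auto)
  then have I: "balg_ideal A ?I"
    by (rule balg_ideal_residual[OF _ a(1)])
  have "one A \<notin> ?I"
    using a meet_one meet_commute one_closed by auto
  from exists_point_avoiding_ideal[OF I this]
  obtain x where x: "x \<in> points A" "\<forall>c\<in>?I. \<not> x c"
    by (rule bexE)
  have "compl A a \<in> ?I"
    using a meet_compl meet_commute compl_closed by auto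
  with x(2) have "\<not> x (compl A a)"
    by (rule bspec)
  then show ?thesis
    using x(1) a(1) by (auto simp: points_iff)
qed

text \<open>For the full set of points, neither intersecting with it nor passing to the subspace
  changes anything, so the two conditions reduce to \<open>exists_point_at\<close> and
  \<open>clopens_stone_space\<close>.\<close>

lemma dz_algebra_points: "dz_algebra (A, points A)"
proof -
  have "points A \<inter> stone_set A a = stone_set A a" for a
    by (auto simp: stone_set_def)
  moreover have "subtopology (stone_space A) (points A) = stone_space A"
    using subtopology_topspace[of "stone_space A"] topspace_stone_space[OF bool_alg_axioms]
    by simp
  ultimately show ?thesis
    using exists_point_at bool_alg_axioms
    by (simp add: dz_algebra_def z_algebra_def clopens_stone_space)
qed

end


section \<open>The categories and the isomorphism\<close>

lemma bool_hom_ident: "bool_alg A \<Longrightarrow> (\<lambda>a\<in>carr A. a) \<in> bool_hom A A"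
  by (simp add: bool_hom_def bool_alg.join_closed bool_alg.meet_closed bool_alg.compl_closed
      bool_alg.zero_closed bool_alg.one_closed)

lemma bool_hom_funcset: "\<phi> \<in> bool_hom A B \<Longrightarrow> \<phi> \<in> carr A \<rightarrow> carr B"
  and bool_hom_extensional: "\<phi> \<in> bool_hom A B \<Longrightarrow> \<phi> \<in> extensional (carr A)"
  by (auto simp: bool_hom_def PiE_iff)

lemma bool_hom_compose:
  assumes "bool_alg A" "\<phi> \<in> bool_hom A B" "\<psi> \<in> bool_hom B C"
  shows "compose (carr A) \<psi> \<phi> \<in> bool_hom A C"
proof -
  interpret bool_alg A by fact
  show ?thesis
    using assms(2,3) unfolding bool_hom_def
    by (simp add: compose_def join_closed meet_closed compl_closed zero_closed one_closed PiE_iff)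
qed

text \<open>Only extensionality enters and no codomain, so the law covers homomorphisms, points and
  maps between sets of points alike.\<close>

lemma compose_restrict_id: "f \<in> extensional A \<Longrightarrow> compose A f (\<lambda>x\<in>A. x) = f"
  by (auto simp: compose_def extensional_def fun_eq_iff)

lemma category_Boole: "category (Boole :: ('a balg, 'a \<Rightarrow> 'a) cat)"
proof
  fix f g h :: "'a \<Rightarrow> 'a" and W X Y Z :: "'a balg"
  show "f \<in> Hom Boole X Y \<Longrightarrow> X \<in> Obj Boole \<and> Y \<in> Obj Boole"
    by (simp add: Boole_def split: if_splits)
  show "X \<in> Obj Boole \<Longrightarrow> Ident Boole X \<in> Hom Boole X X"
    by (simp add: Boole_def bool_hom_ident)
  show "\<lbrakk>f \<in> Hom Boole X Y; g \<in> Hom Boole Y Z\<rbrakk> \<Longrightarrow> Comp Boole X Y Z g f \<in> Hom Boole X Z"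
    by (auto simp: Boole_def bool_hom_compose split: if_splits)
  show "f \<in> Hom Boole X Y \<Longrightarrow> Comp Boole X X Y f (Ident Boole X) = f"
    by (auto simp: Boole_def compose_restrict_id bool_hom_extensional split: if_splits)
  show "f \<in> Hom Boole X Y \<Longrightarrow> Comp Boole X Y Y (Ident Boole Y) f = f"
    by (auto simp: Boole_def Id_compose bool_hom_extensional bool_hom_funcset split: if_splits)
  show "\<lbrakk>f \<in> Hom Boole W X; g \<in> Hom Boole X Y; h \<in> Hom Boole Y Z\<rbrakk> \<Longrightarrow>
      Comp Boole W Y Z h (Comp Boole W X Y g f) = Comp Boole W X Z (Comp Boole X Y Z h g) f"
    by (auto simp: Boole_def compose_assoc[OF bool_hom_funcset] split: if_splits)
qed

section \<open>The category of dz-algebras and its compact part\<close>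

lemma dz_hom_iff:
  "(\<phi>, f) \<in> dz_hom (A, X) (B, Y) \<longleftrightarrow>
     \<phi> \<in> bool_hom A B \<and> f \<in> Y \<rightarrow>\<^sub>E X \<and> (\<forall>y\<in>Y. compose (carr A) y \<phi> = f y)"
  by (simp add: dz_hom_def)

lemma dz_algebraD: "dz_algebra (A, X) \<Longrightarrow> bool_alg A \<and> X \<subseteq> points A"
  by (simp add: dz_algebra_def z_algebra_def)

lemma dz_hom_ident:
  assumes "dz_algebra (A, X)"
  shows "(\<lambda>a\<in>carr A. a, \<lambda>x\<in>X. x) \<in> dz_hom (A, X) (A, X)"
  using dz_algebraD[OF assms]
  by (auto simp: dz_hom_iff bool_hom_ident compose_restrict_id points_def bool_hom_extensional)

lemma dz_hom_compose:
  assumes "bool_alg A" "(\<phi>, f) \<in> dz_hom (A, X) (B, Y)" "(\<psi>, g) \<in> dz_hom (B, Y) (C, Z)"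
  shows "(compose (carr A) \<psi> \<phi>, compose Z f g) \<in> dz_hom (A, X) (C, Z)"
proof -
  have \<phi>: "\<phi> \<in> bool_hom A B" and f: "f \<in> Y \<rightarrow>\<^sub>E X"
    and \<phi>f: "\<And>y. y \<in> Y \<Longrightarrow> compose (carr A) y \<phi> = f y"
    and \<psi>: "\<psi> \<in> bool_hom B C" and g: "g \<in> Z \<rightarrow>\<^sub>E Y"
    and \<psi>g: "\<And>z. z \<in> Z \<Longrightarrow> compose (carr B) z \<psi> = g z"
    using assms(2,3) by (auto simp: dz_hom_iff)
  have "compose (carr A) z (compose (carr A) \<psi> \<phi>) = f (g z)" if "z \<in> Z" for z
    \<comment> \<open>Reassociating puts \<psi> next to z, giving g z; precomposing this point with
      \<phi> then gives f (g z).\<close>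
    using compose_assoc[OF bool_hom_funcset[OF \<phi>], of z \<psi>] \<psi>g[OF that]
      \<phi>f[OF PiE_mem[OF g that]] by simp
  moreover have "compose Z f g \<in> Z \<rightarrow>\<^sub>E X"
    using f g by (auto simp: compose_def)
  ultimately show ?thesis
    using bool_hom_compose[OF assms(1) \<phi> \<psi>] by (simp add: dz_hom_iff compose_eq)
qed

lemma category_dzBoole: "category dzBoole"
proof
  fix P Q R S :: "'a balg \<times> ('a \<Rightarrow> bool) set"
    and u v w :: "('a \<Rightarrow> 'a) \<times> (('a \<Rightarrow> bool) \<Rightarrow> ('a \<Rightarrow> bool))"
  obtain A W B X C Y D Z where P: "P = (A, W)" and Q: "Q = (B, X)" and R: "R = (C, Y)"
    and S: "S = (D, Z)"
    by (metis surj_pair)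
  obtain \<phi> f \<psi> g \<chi> h where u: "u = (\<phi>, f)" and v: "v = (\<psi>, g)" and w: "w = (\<chi>, h)"
    by (metis surj_pair)
  note split = P Q R S u v w
  \<comment> \<open>Second components compose backwards, so each identity law of pairs needs a left
    law in one component and a right law in the other; typing and extensionality of both are
    collected here.\<close>
  have hom: "\<phi> \<in> bool_hom A' B' \<and> \<phi> \<in> carr A' \<rightarrow> carr B' \<and> \<phi> \<in> extensional (carr A') \<and>
      f \<in> X' \<rightarrow> W' \<and> f \<in> extensional X'"
    if "(\<phi>, f) \<in> dz_hom (A', W') (B', X')"
    for \<phi> f and A' B' :: "'a balg" and W' X'
    using that by (auto simp: dz_hom_iff PiE_iff bool_hom_extensional dest: bool_hom_funcset)
  show "u \<in> Hom dzBoole P Q \<Longrightarrow> P \<in> Obj dzBoole \<and> Q \<in> Obj dzBoole"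
    by (simp add: dzBoole_def split: if_splits)
  show "P \<in> Obj dzBoole \<Longrightarrow> Ident dzBoole P \<in> Hom dzBoole P P"
    by (simp add: dzBoole_def split dz_hom_ident)
  show "\<lbrakk>u \<in> Hom dzBoole P Q; v \<in> Hom dzBoole Q R\<rbrakk> \<Longrightarrow> Comp dzBoole P Q R v u \<in> Hom dzBoole P R"
    by (auto simp: dzBoole_def split dz_algebraD intro!: dz_hom_compose split: if_splits)
  show "u \<in> Hom dzBoole P Q \<Longrightarrow> Comp dzBoole P P Q u (Ident dzBoole P) = u"
    by (auto simp: dzBoole_def split compose_restrict_id Id_compose dest!: hom split: if_splits)
  show "u \<in> Hom dzBoole P Q \<Longrightarrow> Comp dzBoole P Q Q (Ident dzBoole Q) u = u"
    by (auto simp: dzBoole_def split compose_restrict_id Id_compose dest!: hom split: if_splits)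
  show "\<lbrakk>u \<in> Hom dzBoole P Q; v \<in> Hom dzBoole Q R; w \<in> Hom dzBoole R S\<rbrakk> \<Longrightarrow>
      Comp dzBoole P R S w (Comp dzBoole P Q R v u) =
      Comp dzBoole P Q S (Comp dzBoole Q R S w v) u"
    by (auto simp: dzBoole_def split compose_assoc dest!: hom split: if_splits)
qed

lemma category_full_subcategory:
  assumes "category C" "S \<subseteq> Obj C"
  shows "category (full_subcategory C S)"
proof -
  interpret category C by fact
  show ?thesis
    by unfold_locales
      (use assms(2) in \<open>auto simp: full_subcategory_def ident_hom comp_ident_right comp_ident_left
        intro: comp_hom comp_assoc split: if_splits\<close>)
qed

text \<open>The Stone-theoretic work enters here: \<open>dz_algebra_points\<close> places the
  compact dz-algebras among the objects of \<open>dzBoole\<close>.\<close>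

lemma category_kBoole: "category kBoole"
  unfolding kBoole_def
  by (rule category_full_subcategory[OF category_dzBoole])
    (auto simp: compact_dz_algebras_def dzBoole_def bool_alg.dz_algebra_points)

section \<open>Stone duals of homomorphisms and the arrows of \<open>kBoole\<close>\<close>

definition dual_map :: "'a balg \<Rightarrow> 'b balg \<Rightarrow> ('a \<Rightarrow> 'b) \<Rightarrow> ('b \<Rightarrow> bool) \<Rightarrow> ('a \<Rightarrow> bool)" where
  "dual_map A B \<phi> = (\<lambda>y\<in>points B. compose (carr A) y \<phi>)"

lemma dual_map_in_points:
  "\<lbrakk>bool_alg A; \<phi> \<in> bool_hom A B; y \<in> points B\<rbrakk> \<Longrightarrow> dual_map A B \<phi> y \<in> points A"
  by (simp add: dual_map_def points_def bool_hom_compose)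

text \<open>Compatibility fixes f on \<open>points B\<close> and extensionality fixes it elsewhere.
  Conversely, precomposing a point with a homomorphism always gives a point, so every \<phi>
  occurs.\<close>

lemma dz_hom_points_iff:
  assumes "bool_alg A"
  shows "(\<phi>, f) \<in> dz_hom (A, points A) (B, points B) \<longleftrightarrow>
    \<phi> \<in> bool_hom A B \<and> f = dual_map A B \<phi>"
proof
  assume "(\<phi>, f) \<in> dz_hom (A, points A) (B, points B)"
  then have "\<phi> \<in> bool_hom A B" "f \<in> extensional (points B)"
    "\<forall>y\<in>points B. f y = compose (carr A) y \<phi>"
    by (auto simp: dz_hom_iff PiE_iff)
  then show "\<phi> \<in> bool_hom A B \<and> f = dual_map A B \<phi>"
    by (auto simp: dual_map_def extensional_def fun_eq_iff)
next
  assume h: "\<phi> \<in> bool_hom A B \<and> f = dual_map A B \<phi>"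
  then have "f \<in> points B \<rightarrow>\<^sub>E points A"
    by (auto simp: dual_map_in_points[OF assms]) (simp add: dual_map_def)
  then show "(\<phi>, f) \<in> dz_hom (A, points A) (B, points B)"
    using h by (auto simp: dz_hom_iff dual_map_def)
qed

lemma dual_map_ident: "dual_map A A (\<lambda>a\<in>carr A. a) = (\<lambda>x\<in>points A. x)"
  by (auto simp: dual_map_def compose_restrict_id points_iff)

lemma dual_map_compose:
  assumes "bool_alg B" "\<phi> \<in> bool_hom A B" "\<psi> \<in> bool_hom B C"
  shows "dual_map A C (compose (carr A) \<psi> \<phi>) =
    compose (points C) (dual_map A B \<phi>) (dual_map B C \<psi>)"
proof
  fix z
  show "dual_map A C (compose (carr A) \<psi> \<phi>) z =
      compose (points C) (dual_map A B \<phi>) (dual_map B C \<psi>) z"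
  proof (cases "z \<in> points C")
    case True
    then show ?thesis
      using dual_map_in_points[OF assms(1,3)] compose_assoc[OF bool_hom_funcset[OF assms(2)]]
      by (simp add: compose_eq dual_map_def)
  \<comment> \<open>Off \<open>points C\<close> both sides are \<open>undefined\<close>.\<close>
  qed (simp add: compose_def dual_map_def)
qed

lemma Obj_kBoole: "Obj kBoole = {(A, points A) | A. bool_alg A}"
  by (simp add: kBoole_def full_subcategory_def compact_dz_algebras_def)

lemma Hom_kBoole:
  assumes "bool_alg A" "bool_alg B"
  shows "Hom kBoole (A, points A) (B, points B) =
    (\<lambda>\<phi>. (\<phi>, dual_map A B \<phi>)) ` bool_hom A B"
  using assms bool_alg.dz_algebra_points
  by (auto simp: kBoole_def full_subcategory_def compact_dz_algebras_def dzBoole_def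
      dz_hom_points_iff)

lemma Ident_kBoole: "Ident kBoole (A, X) = (\<lambda>a\<in>carr A. a, \<lambda>x\<in>X. x)"
  and Comp_kBoole: "Comp kBoole (A, X) (B, Y) (C, Z) (\<psi>, g) (\<phi>, f) =
    (compose (carr A) \<psi> \<phi>, compose Z f g)"
  by (simp_all add: kBoole_def full_subcategory_def dzBoole_def)

text \<open>Brings an arrow between unspecified objects into the standard form, so that the functor
  laws for \<open>fst\<close> reduce to simplification.\<close>

lemma Hom_kBooleE:
  assumes "u \<in> Hom kBoole P Q"
  obtains A B \<phi> where "bool_alg A" "bool_alg B" "P = (A, points A)" "Q = (B, points B)"
    "\<phi> \<in> bool_hom A B" "u = (\<phi>, dual_map A B \<phi>)"
proof -
  have "P \<in> Obj kBoole \<and> Q \<in> Obj kBoole"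
    using category.hom_obj[OF category_kBoole assms] .
  then obtain A B where AB: "bool_alg A" "bool_alg B" "P = (A, points A)" "Q = (B, points B)"
    by (auto simp: Obj_kBoole)
  then show ?thesis
    using assms that by (auto simp: Hom_kBoole)
qed

section \<open>The two mutually inverse functors\<close>

lemma functor_Boole_kBoole:
  "cat_functor Boole kBoole (\<lambda>A. (A, points A)) (\<lambda>A B \<phi>. (\<phi>, dual_map A B \<phi>))"
  by (intro cat_functor.intro category_Boole category_kBoole cat_functor_axioms.intro)
    (auto simp: Boole_def Obj_kBoole Hom_kBoole Ident_kBoole Comp_kBoole dual_map_ident
      dual_map_compose split: if_splits)

lemma functor_kBoole_Boole: "cat_functor kBoole Boole fst (\<lambda>P Q. fst)"
  by (intro cat_functor.intro category_Boole category_kBoole cat_functor_axioms.intro)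
    (auto simp: Boole_def Obj_kBoole Ident_kBoole Comp_kBoole elim!: Hom_kBooleE)

theorem proposition5p1:
  shows "isomorphic_categories
    (Boole :: ('a balg, 'a \<Rightarrow> 'a) cat)
    (kBoole :: ('a balg \<times> ('a \<Rightarrow> bool) set, ('a \<Rightarrow> 'a) \<times> (('a \<Rightarrow> bool) \<Rightarrow> ('a \<Rightarrow> bool))) cat)"
  unfolding isomorphic_categories_def
proof (intro conjI exI)
  show "cat_functor Boole kBoole (\<lambda>A. (A, points A)) (\<lambda>A B \<phi>. (\<phi>, dual_map A B \<phi>))"
    by (rule functor_Boole_kBoole)
  show "cat_functor kBoole Boole fst (\<lambda>P Q. fst)"
    by (rule functor_kBoole_Boole)
  show "\<forall>P\<in>Obj kBoole. (fst P, points (fst P)) = P"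
    by (auto simp: Obj_kBoole)
  \<comment> \<open>The discarded second component is recovered because it is forced to be the dual
    of the first. The round trips starting in \<open>Boole\<close> are projections of pairs and fall
    to the closing \<open>simp_all\<close>.\<close>
  show "\<forall>P\<in>Obj kBoole. \<forall>Q\<in>Obj kBoole. \<forall>u\<in>Hom kBoole P Q.
      (fst u, dual_map (fst P) (fst Q) (fst u)) = u"
    by (auto elim!: Hom_kBooleE)
qed (simp_all add: category_Boole category_kBoole)

end
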